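(* Let $\Omega$ be a metric space with Borel $\sigma$-field $\mathcal{F}$, let $\mathcal{M}$ be a convex, weak$^*$-closed set of probability measures on $(\Omega,\mathcal{F})$, and let $\mathcal{H}=\mathcal{L}^1(\Omega,\mathcal{F},\mathcal{M})$ be the Banach space obtained as the closure of the bounded continuous functions on $\Omega$ under $\|X\|_{\mathcal{M}}:=\sup_{\mathbb{P}\in\mathcal{M}}\mathbb{E}_{\mathbb{P}}|X|$ (identifying functions that are $\mathbb{P}$-a.s. equal for every $\mathbb{P}\in\mathcal{M}$), with norm topology $\tau$. Let the pre-order be given by $$X\le Y\iff \mathbb{E}_{\mathbb{P}}[X]\le\mathbb{E}_{\mathbb{P}}[Y]\ \text{ for all }\mathbb{P}\in\mathcal{M},$$ let $$\mathcal{R}=\Big\{R\in\mathcal{H}: 0\le\inf_{\mathbb{P}\in\mathcal{M}}\mathbb{E}_{\mathbb{P}}[R]\ \text{ and }\ 0<\sup_{\mathbb{P}\in\mathcal{M}}\mathbb{E}_{\mathbb{P}}[R]\Big\},$$ and let $\mathcal{I}\subset\mathcal{H}$ be the linear subspace of net trades of a frictionless finite-horizon discrete-time financial market (see context). If the financial market $(\mathcal{H},\tau,\le,\mathcal{I},\mathcal{R})$ is viable, then the set $\mathcal{Q}_{ac}$ of absolutely continuous martingale functionals is a subset of $\mathcal{M}$; that is, for every $\varphi\in\mathcal{Q}_{ac}$ there is $\mathbb{P}\in\mathcal{M}$ with $\varphi(X)=\mathbb{E}_{\mathbb{P}}[X]$ for all $X\in\mathcal{H}$.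
   Context: Weak$^*$-closedness of $\mathcal{M}$: each $\mathbb{P}\in\mathcal{M}$ is identified with the functional $X\mapsto\mathbb{E}_{\mathbb{P}}[X]$ in the topological dual $\mathcal{H}'$, and $\mathcal{M}$, viewed as a subset of $\mathcal{H}'$, is closed in the weak$^*$ topology induced by $\mathcal{H}$. Net trades: there are a filtration $(\mathcal{F}_t)_{t=0}^T$ on $(\Omega,\mathcal{F})$ ($T\ge1$), an adapted $\mathbb{R}^J_+$-valued process $S=(S_t)_{t=0}^T$ (discounted prices, with a riskless bond with interest rate zero), and $\mathcal{I}$ is the set of $\ell\in\mathcal{H}$ of the form $\ell=\sum_{t=1}^T H_t\cdot(S_t-S_{t-1})$ with $H_t$ an $\mathcal{F}_{t-1}$-measurable $\mathbb{R}^J$-valued function; $\mathcal{I}$ is a linear subspace of $\mathcal{H}$. Agents: $\mathcal{A}$ is the set of complete and transitive binary relations $\preceq$ on $\mathcal{H}$ (with strict part $\prec$) that are (i) weakly monotone: $X\le Y$ implies $X\preceq Y$; (ii) convex: $\{Z\in\mathcal{H}: X\preceq Z\}$ is convex for every $X$; (iii) $\tau$-lower semi-continuous: if $X_n\to X$ in $\tau$ and $X_n\preceq Y$ for all $n$, then $X\preceq Y$. Viability: the market is viable if there is a family $\{\preceq_a\}_{a\in A}\subset\mathcal{A}$ such that $\ell\preceq_a 0$ for every $a\in A$ and $\ell\in\mathcal{I}$, and for every $R\in\mathcal{R}$ there is $a\in A$ with $0\prec_a R$. Martingale functionals: $\mathcal{H}'_+$ is the set of $\varphi\in\mathcal{H}'$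 with $\varphi(X)\ge0$ for every $X\in\mathcal{H}$ with $X\ge0$. $\varphi\in\mathcal{H}'_+$ is a martingale functional if $\varphi(1)=1$ and $\varphi(\ell)\le0$ for all $\ell\in\mathcal{I}$; it is absolutely continuous if $\varphi(Z)=0$ for all negligible $Z$ (those with $0\le Z$ and $Z\le0$). $\mathcal{Q}_{ac}$ is the set of absolutely continuous martingale functionals. *)

theory Defs
  imports "HOL-Probability.Probability"
begin

section \<open>Agents, viability and martingale functionals of a market\<close>

text \<open>
  The definitions of this section are parametrised by the components
  \<open>(H, \<tau>, le, I, R)\<close> of a market, where \<open>H\<close> is a set of real functions on the sample space.
  Elements of \<open>H\<close> are representatives: two functions that are equivalent for the pre-order
  \<open>le\<close> are not identified. No condition of well-definedness has to be added to relations on \<open>H\<close>: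
  by weak monotonicity and transitivity, an agent's preferences cannot distinguish \<open>X\<close> from \<open>Y\<close>
  when both \<open>le X Y\<close> and \<open>le Y X\<close> hold.
\<close>

definition agents ::
  "('a \<Rightarrow> real) set \<Rightarrow> ('a \<Rightarrow> real) topology \<Rightarrow> (('a \<Rightarrow> real) \<Rightarrow> ('a \<Rightarrow> real) \<Rightarrow> bool) \<Rightarrow>
    (('a \<Rightarrow> real) \<Rightarrow> ('a \<Rightarrow> real) \<Rightarrow> bool) set" where
  "agents H \<tau> le = {pref.
     (\<forall>X\<in>H. \<forall>Y\<in>H. pref X Y \<or> pref Y X) \<and>
     (\<forall>X\<in>H. \<forall>Y\<in>H. \<forall>Z\<in>H. pref X Y \<longrightarrow> pref Y Z \<longrightarrow> pref X Z) \<and>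
     (\<forall>X\<in>H. \<forall>Y\<in>H. le X Y \<longrightarrow> pref X Y) \<and>
     (\<forall>X\<in>H. \<forall>Y\<in>H. \<forall>Z\<in>H. \<forall>u\<in>{0..1::real}. pref X Y \<longrightarrow> pref X Z \<longrightarrow>
        pref X (\<lambda>\<omega>. (1 - u) * Y \<omega> + u * Z \<omega>)) \<and>
     (\<forall>Xs X Y. (\<forall>n. Xs n \<in> H) \<longrightarrow> X \<in> H \<longrightarrow> Y \<in> H \<longrightarrow> limitin \<tau> Xs X sequentially \<longrightarrow>
        (\<forall>n::nat. pref (Xs n) Y) \<longrightarrow> pref X Y)}"

text \<open>A family of agents enters only through the set of its members.\<close>

definition viable ::
  "('a \<Rightarrow> real) set \<Rightarrow> ('a \<Rightarrow> real) topology \<Rightarrow> (('a \<Rightarrow> real) \<Rightarrow> ('a \<Rightarrow> real) \<Rightarrow> bool) \<Rightarrow>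
    ('a \<Rightarrow> real) set \<Rightarrow> ('a \<Rightarrow> real) set \<Rightarrow> bool" where
  "viable H \<tau> le I R \<longleftrightarrow> (\<exists>\<A>\<subseteq>agents H \<tau> le.
     (\<forall>pref\<in>\<A>. \<forall>l\<in>I. pref l (\<lambda>\<omega>. 0)) \<and>
     (\<forall>r\<in>R. \<exists>pref\<in>\<A>. pref (\<lambda>\<omega>. 0) r \<and> \<not> pref r (\<lambda>\<omega>. 0)))"

text \<open>
  Functionals are functions on \<open>H\<close> only, that is, they are extensional. This makes equality of
  functionals agree with equality on \<open>H\<close>.
\<close>

definition dual :: "('a \<Rightarrow> real) set \<Rightarrow> ('a \<Rightarrow> real) topology \<Rightarrow> (('a \<Rightarrow> real) \<Rightarrow> real) set" where
  "dual H \<tau> = {\<phi> \<in> extensional H.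
     (\<forall>X\<in>H. \<forall>Y\<in>H. \<phi> (\<lambda>\<omega>. X \<omega> + Y \<omega>) = \<phi> X + \<phi> Y) \<and>
     (\<forall>c. \<forall>X\<in>H. \<phi> (\<lambda>\<omega>. c * X \<omega>) = c * \<phi> X) \<and>
     continuous_map \<tau> euclideanreal \<phi>}"

text \<open>The product topology is the topology of pointwise convergence on \<open>H\<close>.\<close>

definition weak_star_topology ::
  "('a \<Rightarrow> real) set \<Rightarrow> ('a \<Rightarrow> real) topology \<Rightarrow> (('a \<Rightarrow> real) \<Rightarrow> real) topology" where
  "weak_star_topology H \<tau> = subtopology (product_topology (\<lambda>_. euclideanreal) H) (dual H \<tau>)"

definition dual_pos ::
  "('a \<Rightarrow> real) set \<Rightarrow> ('a \<Rightarrow> real) topology \<Rightarrow> (('a \<Rightarrow> real) \<Rightarrow> ('a \<Rightarrow> real) \<Rightarrow> bool) \<Rightarrow>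
    (('a \<Rightarrow> real) \<Rightarrow> real) set" where
  "dual_pos H \<tau> le = {\<phi> \<in> dual H \<tau>. \<forall>X\<in>H. le (\<lambda>\<omega>. 0) X \<longrightarrow> 0 \<le> \<phi> X}"

definition negligible_claims ::
  "('a \<Rightarrow> real) set \<Rightarrow> (('a \<Rightarrow> real) \<Rightarrow> ('a \<Rightarrow> real) \<Rightarrow> bool) \<Rightarrow> ('a \<Rightarrow> real) set" where
  "negligible_claims H le = {Z \<in> H. le (\<lambda>\<omega>. 0) Z \<and> le Z (\<lambda>\<omega>. 0)}"

definition martingale_functionals ::
  "('a \<Rightarrow> real) set \<Rightarrow> ('a \<Rightarrow> real) topology \<Rightarrow> (('a \<Rightarrow> real) \<Rightarrow> ('a \<Rightarrow> real) \<Rightarrow> bool) \<Rightarrow>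
    ('a \<Rightarrow> real) set \<Rightarrow> (('a \<Rightarrow> real) \<Rightarrow> real) set" where
  "martingale_functionals H \<tau> le I =
     {\<phi> \<in> dual_pos H \<tau> le. \<phi> (\<lambda>\<omega>. 1) = 1 \<and> (\<forall>l\<in>I. \<phi> l \<le> 0)}"

definition ac_martingale_functionals ::
  "('a \<Rightarrow> real) set \<Rightarrow> ('a \<Rightarrow> real) topology \<Rightarrow> (('a \<Rightarrow> real) \<Rightarrow> ('a \<Rightarrow> real) \<Rightarrow> bool) \<Rightarrow>
    ('a \<Rightarrow> real) set \<Rightarrow> (('a \<Rightarrow> real) \<Rightarrow> real) set" where
  "ac_martingale_functionals H \<tau> le I =
     {\<phi> \<in> martingale_functionals H \<tau> le I. \<forall>Z\<in>negligible_claims H le. \<phi> Z = 0}"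

section \<open>The space \<open>\<L>\<^sup>1(\<Omega>, \<F>, \<M>)\<close>\<close>

text \<open>
  The supremum is taken in \<^typ>\<open>ennreal\<close>, so that no boundedness or nonemptiness condition is
  needed; on \<open>L1 M\<close> the value is finite.
\<close>

definition sup_norm :: "'a measure set \<Rightarrow> ('a \<Rightarrow> real) \<Rightarrow> ennreal" where
  "sup_norm M X = (SUP P\<in>M. \<integral>\<^sup>+\<omega>. ennreal \<bar>X \<omega>\<bar> \<partial>P)"

text \<open>
  Elements are Borel representatives, and equality in the Banach space is equality almost surely
  under every member of \<open>M\<close>, that is, vanishing of \<open>sup_norm\<close> of the difference. All notions
  below are compatible with it; in particular a functional that is continuous for \<open>L1_topology\<close>
  and linear takes the same value on identified functions.
\<close>

definition L1 :: "'a::metric_space measure set \<Rightarrow> ('a \<Rightarrow> real) set" where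
  "L1 M = {X \<in> borel_measurable borel.
     \<forall>e>0. \<exists>f. continuous_on UNIV f \<and> bounded (range f) \<and> sup_norm M (\<lambda>\<omega>. X \<omega> - f \<omega>) < e}"

text \<open>
  The topology of the seminorm on representatives; its Kolmogorov quotient is the norm topology.
\<close>

definition L1_topology :: "'a::metric_space measure set \<Rightarrow> ('a \<Rightarrow> real) topology" where
  "L1_topology M = topology_generated_by
     {{Y \<in> L1 M. sup_norm M (\<lambda>\<omega>. Y \<omega> - X \<omega>) < e} | X e. X \<in> L1 M \<and> 0 < e}"

definition mean_le :: "'a measure set \<Rightarrow> ('a \<Rightarrow> real) \<Rightarrow> ('a \<Rightarrow> real) \<Rightarrow> bool" where
  "mean_le M X Y \<longleftrightarrow> (\<forall>P\<in>M. (\<integral>\<omega>. X \<omega> \<partial>P) \<le> (\<integral>\<omega>. Y \<omega> \<partial>P))"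

definition relevant_claims :: "'a::metric_space measure set \<Rightarrow> ('a \<Rightarrow> real) set" where
  "relevant_claims M = {R \<in> L1 M.
     0 \<le> (INF P\<in>M. ereal (\<integral>\<omega>. R \<omega> \<partial>P)) \<and> 0 < (SUP P\<in>M. ereal (\<integral>\<omega>. R \<omega> \<partial>P))}"

definition expectation_functional ::
  "'a::metric_space measure set \<Rightarrow> 'a measure \<Rightarrow> ('a \<Rightarrow> real) \<Rightarrow> real" where
  "expectation_functional M P = (\<lambda>X\<in>L1 M. \<integral>\<omega>. X \<omega> \<partial>P)"

definition weak_star_closed :: "'a::metric_space measure set \<Rightarrow> bool" where
  "weak_star_closed M \<longleftrightarrow>
     closedin (weak_star_topology (L1 M) (L1_topology M)) (expectation_functional M ` M)"

text \<open>
  There is no addition of measures in the library; for probability measures on the same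
  \<open>\<sigma>\<close>-algebra, \<open>R\<close> below is the mixture \<open>(1 - u) P + u Q\<close>.
\<close>

definition convex_measures :: "'a measure set \<Rightarrow> bool" where
  "convex_measures M \<longleftrightarrow> (\<forall>P\<in>M. \<forall>Q\<in>M. \<forall>u\<in>{0..1::real}. \<exists>R\<in>M. sets R = sets P \<and>
     (\<forall>A\<in>sets P. measure R A = (1 - u) * measure P A + u * measure Q A))"

section \<open>The discrete-time financial market\<close>

definition filtration_upto :: "'a measure \<Rightarrow> nat \<Rightarrow> (nat \<Rightarrow> 'a measure) \<Rightarrow> bool" where
  "filtration_upto N T F \<longleftrightarrow>
     (\<forall>t\<le>T. subalgebra N (F t)) \<and> (\<forall>t\<le>T. \<forall>s\<le>t. subalgebra (F t) (F s))"

definition net_trades ::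
  "'a::metric_space measure set \<Rightarrow> nat \<Rightarrow> (nat \<Rightarrow> 'a measure) \<Rightarrow> (nat \<Rightarrow> 'a \<Rightarrow> real ^ 'j) \<Rightarrow>
    ('a \<Rightarrow> real) set" where
  "net_trades M T F S = {l \<in> L1 M. \<exists>h :: nat \<Rightarrow> 'a \<Rightarrow> real ^ 'j.
     (\<forall>t\<in>{1..T}. h t \<in> borel_measurable (F (t - 1))) \<and>
     (\<forall>P\<in>M. AE \<omega> in P. l \<omega> = (\<Sum>t=1..T. h t \<omega> \<bullet> (S t \<omega> - S (t - 1) \<omega>)))}"

end

theory Submission
  imports Defs
begin

text \<open>
  If an absolutely continuous martingale functional \<open>\<phi>\<close> were not an expectation under a member of
  \<open>M\<close>, weak* closedness would keep it away from \<open>M\<close> on finitely many test claims, and a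
  finite-dimensional separation would yield a linear combination \<open>X\<close> of these and a constant \<open>c\<close>
  with \<open>E\<^sub>P[X] \<le> c < \<phi> X\<close> for all \<open>P \<in> M\<close>. Then \<open>c - X\<close> is nonnegative in the pre-order but has a
  negative price.
\<close>

section \<open>Separating a point from a bounded convex set in finitely many coordinates\<close>

text \<open>
  A near-minimiser of the distance to \<open>p\<close> replaces the closest point, so that neither closures nor a
  type of the right dimension are needed.
\<close>

lemma separation_of_distant_point:
  fixes K :: "('i \<Rightarrow> real) set" and p B :: "'i \<Rightarrow> real" and e :: real
  assumes convex: "\<And>x y u. x \<in> K \<Longrightarrow> y \<in> K \<Longrightarrow> u \<in> {0..1} \<Longrightarrow>
      \<exists>z\<in>K. \<forall>i\<in>I. z i = (1 - u) * x i + u * y i"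
    and bounded: "\<And>k i. k \<in> K \<Longrightarrow> i \<in> I \<Longrightarrow> \<bar>k i\<bar> \<le> B i"
    and "0 < e"
    and distant: "\<And>k. k \<in> K \<Longrightarrow> e \<le> (\<Sum>i\<in>I. (p i - k i)\<^sup>2)"
  shows "\<exists>a c. (\<forall>k\<in>K. (\<Sum>i\<in>I. a i * k i) \<le> c) \<and> c < (\<Sum>i\<in>I. a i * p i)"
proof (cases "K = {}")
  case True
  \<comment> \<open>Nothing has to be bounded, so the zero functional with any negative
    \<open>c\<close> separates.\<close>
  then show ?thesis
    by (intro exI[of _ "\<lambda>_. 0"] exI[of _ "-1"]) simp
next
  case False
  define g where "g k = (\<Sum>i\<in>I. (p i - k i)\<^sup>2)" for k
  define d where "d = Inf (g ` K)"
  \<comment> \<open>\<open>D\<close> dominates the squared distance between any two points of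
    \<open>K\<close>. The number \<open>t\<close> has two uses: it is the convex weight of a step
    inside \<open>K\<close>, and \<open>t\<^sup>2\<close> is the tolerance of the near-minimiser.
    Its choice keeps the resulting error \<open>t * (1 + D) / 2\<close> at or below
    \<open>e / 2\<close>.\<close>
  define D where "D = (\<Sum>i\<in>I. (2 * B i)\<^sup>2)"
  define t where "t = min 1 (e / (1 + D))"
  have D: "0 \<le> D"
    by (simp add: D_def sum_nonneg)
  have "t \<le> e / (1 + D)"
    by (simp add: t_def)
  with D have "t * (1 + D) \<le> e"
    by (simp add: pos_le_divide_eq)
  with D \<open>0 < e\<close> have t: "0 < t" "t \<le> 1" "t * (1 + D) \<le> e"
    by (auto simp: t_def)
  have bdd: "bdd_below (g ` K)"
    using distant by (auto simp: g_def intro!: bdd_belowI)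
  have d: "d \<le> g k" if "k \<in> K" for k
    unfolding d_def using that bdd by (intro cInf_lower) auto
  have "d < d + t\<^sup>2"
    using t by simp
  then obtain k where k: "k \<in> K" "g k < d + t\<^sup>2"
    using cInf_lessD[of "g ` K" "d + t\<^sup>2"] False by (auto simp flip: d_def)
  define a where "a i = p i - k i" for i
  \<comment> \<open>A step of weight \<open>t\<close> from \<open>k\<close> towards
    \<open>k'\<close> stays in \<open>K\<close>, so it cannot bring \<open>g\<close> below
    \<open>d\<close>, and hence lowers \<open>g k\<close> by less than \<open>t\<^sup>2\<close>.
    Expanding the square at the new point and dividing by \<open>2 * t\<close> bounds the
    first-order term \<open>q\<close>.\<close>
  have upper: "(\<Sum>i\<in>I. a i * k' i) \<le> (\<Sum>i\<in>I. a i * k i) + t * (1 + D) / 2" if k': "k' \<in> K" for k'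
  proof -
    obtain z where z: "z \<in> K" "\<And>i. i \<in> I \<Longrightarrow> z i = (1 - t) * k i + t * k' i"
      using convex[OF k(1) k', of t] t(1,2) by force
    define q where "q = (\<Sum>i\<in>I. a i * (k' i - k i))"
    have "g z = (\<Sum>i\<in>I. (p i - k i)\<^sup>2 - 2 * t * (a i * (k' i - k i)) + t\<^sup>2 * (k' i - k i)\<^sup>2)"
      unfolding g_def
      by (rule sum.cong) (auto simp: z a_def power2_eq_square algebra_simps)
    also have "\<dots> = g k - 2 * t * q + t\<^sup>2 * (\<Sum>i\<in>I. (k' i - k i)\<^sup>2)"
      by (simp add: g_def q_def sum.distrib sum_subtractf sum_distrib_left)
    also have "\<dots> \<le> g k - 2 * t * q + t\<^sup>2 * D"
    proof -
      have "(k' i - k i)\<^sup>2 \<le> (2 * B i)\<^sup>2" if "i \<in> I" for i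
        using bounded[OF k(1) that] bounded[OF k' that] by (intro abs_le_square_iff[THEN iffD1]) linarith
      then have "(\<Sum>i\<in>I. (k' i - k i)\<^sup>2) \<le> D"
        unfolding D_def by (rule sum_mono)
      then show ?thesis
        by (simp add: mult_left_mono)
    qed
    finally have "2 * t * q < t\<^sup>2 + t\<^sup>2 * D"
      using d[OF z(1)] k(2) by linarith
    then have "t * (2 * q) < t * (t * (1 + D))"
      by (simp add: power2_eq_square algebra_simps)
    then have "2 * q < t * (1 + D)"
      using t(1) by simp
    then show ?thesis
      by (simp add: q_def right_diff_distrib sum_subtractf)
  qed
  \<comment> \<open>Since \<open>a = p - k\<close>, this difference is the squared distance
    \<open>g k\<close>; the gap \<open>e\<close> exceeds the error of at most
    \<open>e / 2\<close>.\<close>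
  have "e \<le> (\<Sum>i\<in>I. a i * p i) - (\<Sum>i\<in>I. a i * k i)"
    using distant[OF k(1)]
    by (simp add: a_def sum_subtractf[symmetric] power2_eq_square algebra_simps)
  then have "(\<Sum>i\<in>I. a i * k i) + t * (1 + D) / 2 < (\<Sum>i\<in>I. a i * p i)"
    using t(3) \<open>0 < e\<close> by linarith
  with upper show ?thesis
    by blast
qed

section \<open>Integration against a mixture of two measures\<close>

text \<open>The mixture is known only through its values on sets. Both sides are additive,
  positively homogeneous and continuous along increasing sequences, so agreement on indicators
  extends by induction on measurable functions.\<close>

lemma nn_integral_mixture:
  assumes sets: "sets R = sets P" "sets Q = sets P"
    and nonneg: "0 \<le> (a::real)" "0 \<le> (b::real)"
    and mix: "\<And>A. A \<in> sets P \<Longrightarrow> emeasure R A = a * emeasure P A + b * emeasure Q A"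
    and f: "f \<in> borel_measurable P"
  shows "(\<integral>\<^sup>+x. f x \<partial>R) = a * (\<integral>\<^sup>+x. f x \<partial>P) + b * (\<integral>\<^sup>+x. f x \<partial>Q)"
  using f
proof (induction rule: borel_measurable_induct)
  case (cong f g)
  have "space R = space P" "space Q = space P"
    using sets by (auto dest: sets_eq_imp_space_eq)
  then have "(\<integral>\<^sup>+x. f x \<partial>N) = (\<integral>\<^sup>+x. g x \<partial>N)" if "N \<in> {R, P, Q}" for N
    using that cong(3) by (intro nn_integral_cong) auto
  then show ?case
    using cong(4) by simp
next
  case (set A)
  then show ?case
    using sets mix by simp
next
  case (mult u c)
  then show ?case
    by (simp add: nn_integral_cmult measurable_cong_sets[OF sets(1) refl]
        measurable_cong_sets[OF sets(2) refl] distrib_left mult.left_commute)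
next
  case (add u v)
  then show ?case
    by (simp add: nn_integral_add measurable_cong_sets[OF sets(1) refl]
        measurable_cong_sets[OF sets(2) refl] distrib_left ac_simps)
next
  case (seq U)
  \<comment> \<open>Monotonicity in \<open>i\<close> is what allows the supremum to be taken
    separately in the two summands.\<close>
  have inc: "incseq (\<lambda>i. c * (\<integral>\<^sup>+x. U i x \<partial>N))" for c :: ennreal and N
    using \<open>incseq U\<close> by (auto simp: incseq_def le_fun_def intro!: mult_left_mono nn_integral_mono)
  have conv: "(\<integral>\<^sup>+x. (SUP i. U i x) \<partial>N) = (SUP i. (\<integral>\<^sup>+x. U i x \<partial>N))" if "sets N = sets P" for N
    using seq(1) \<open>incseq U\<close>
    by (intro nn_integral_monotone_convergence_SUP) (simp_all cong: measurable_cong_sets add: that)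
  have "(\<integral>\<^sup>+x. (SUP i. U i x) \<partial>R) = (SUP i. a * (\<integral>\<^sup>+x. U i x \<partial>P) + b * (\<integral>\<^sup>+x. U i x \<partial>Q))"
    unfolding conv[OF sets(1)] by (intro SUP_cong refl) (rule seq.IH)
  also have "\<dots> = a * (\<integral>\<^sup>+x. (SUP i. U i x) \<partial>P) + b * (\<integral>\<^sup>+x. (SUP i. U i x) \<partial>Q)"
    unfolding conv[OF refl] conv[OF sets(2)] SUP_mult_left_ennreal
    by (rule ennreal_SUP_add[OF inc inc])
  finally show ?case
    by (simp add: SUP_apply image_comp seq)
qed

text \<open>The nonnegative case is applied to the positive and negative parts of \<open>f\<close>;
  integrability keeps all values finite, where \<open>enn2real\<close> respects sums and
  products.\<close>

lemma integral_mixture: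
  fixes f :: "'a \<Rightarrow> real"
  assumes sets: "sets R = sets P" "sets Q = sets P"
    and fin: "finite_measure R" "finite_measure P" "finite_measure Q"
    and nonneg: "0 \<le> a" "0 \<le> b"
    and mix: "\<And>A. A \<in> sets P \<Longrightarrow> measure R A = a * measure P A + b * measure Q A"
    and int: "integrable R f" "integrable P f" "integrable Q f"
  shows "(\<integral>x. f x \<partial>R) = a * (\<integral>x. f x \<partial>P) + b * (\<integral>x. f x \<partial>Q)"
proof -
  have emix: "emeasure R A = a * emeasure P A + b * emeasure Q A" if "A \<in> sets P" for A
    using mix[OF that] nonneg
    by (simp add: finite_measure.emeasure_eq_measure[OF fin(1)]
        finite_measure.emeasure_eq_measure[OF fin(2)]
        finite_measure.emeasure_eq_measure[OF fin(3)] ennreal_mult ennreal_plus)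
  \<comment> \<open>\<open>ennreal\<close> truncates at 0, so \<open>ennreal (g x)\<close> is the
    positive part of \<open>g\<close>; the choices \<open>g = f\<close> and \<open>g = - f\<close>
    give both parts of \<open>f\<close>.\<close>
  have *: "enn2real (\<integral>\<^sup>+x. ennreal (g x) \<partial>R) =
      a * enn2real (\<integral>\<^sup>+x. ennreal (g x) \<partial>P) + b * enn2real (\<integral>\<^sup>+x. ennreal (g x) \<partial>Q)"
    if g: "integrable P g" "integrable Q g" for g
  proof -
    have fin': "(\<integral>\<^sup>+x. ennreal (g x) \<partial>P) < \<top>" "(\<integral>\<^sup>+x. ennreal (g x) \<partial>Q) < \<top>"
      using g by (auto simp: real_integrable_def less_top)
    have "(\<integral>\<^sup>+x. ennreal (g x) \<partial>R) =
        a * (\<integral>\<^sup>+x. ennreal (g x) \<partial>P) + b * (\<integral>\<^sup>+x. ennreal (g x) \<partial>Q)"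
      using g by (intro nn_integral_mixture sets nonneg emix) auto
    then show ?thesis
      using fin' nonneg by (simp add: enn2real_plus enn2real_mult ennreal_mult_less_top)
  qed
  show ?thesis
    using *[of f] *[of "\<lambda>x. - f x"] int
    by (simp add: real_lebesgue_integral_def algebra_simps)
qed

section \<open>The seminorm and the linear structure of \<open>L1 M\<close>\<close>

lemma sup_norm_add_le:
  assumes "\<forall>P\<in>M. sets P = sets borel"
    and "X \<in> borel_measurable borel" "Y \<in> borel_measurable borel"
  shows "sup_norm M (\<lambda>\<omega>. X \<omega> + Y \<omega>) \<le> sup_norm M X + sup_norm M Y"
  unfolding sup_norm_def
proof (rule SUP_least)
  fix P assume P: "P \<in> M"
  have m [measurable]: "X \<in> borel_measurable P" "Y \<in> borel_measurable P"
    using assms P by (simp_all cong: measurable_cong_sets)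
  have "(\<integral>\<^sup>+\<omega>. ennreal \<bar>X \<omega> + Y \<omega>\<bar> \<partial>P) \<le> (\<integral>\<^sup>+\<omega>. ennreal \<bar>X \<omega>\<bar> + ennreal \<bar>Y \<omega>\<bar> \<partial>P)"
    by (intro nn_integral_mono) (simp flip: ennreal_plus)
  also have "\<dots> = (\<integral>\<^sup>+\<omega>. ennreal \<bar>X \<omega>\<bar> \<partial>P) + (\<integral>\<^sup>+\<omega>. ennreal \<bar>Y \<omega>\<bar> \<partial>P)"
    by (intro nn_integral_add) auto
  also have "\<dots> \<le> (SUP P\<in>M. \<integral>\<^sup>+\<omega>. ennreal \<bar>X \<omega>\<bar> \<partial>P) + (SUP P\<in>M. \<integral>\<^sup>+\<omega>. ennreal \<bar>Y \<omega>\<bar> \<partial>P)"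
    using P by (intro add_mono SUP_upper)
  finally show "(\<integral>\<^sup>+\<omega>. ennreal \<bar>X \<omega> + Y \<omega>\<bar> \<partial>P) \<le> \<dots>" .
qed

lemma sup_norm_cmult_le:
  assumes "\<forall>P\<in>M. sets P = sets borel" and "X \<in> borel_measurable borel"
  shows "sup_norm M (\<lambda>\<omega>. c * X \<omega>) \<le> ennreal \<bar>c\<bar> * sup_norm M X"
  unfolding sup_norm_def
proof (rule SUP_least)
  fix P assume P: "P \<in> M"
  have [measurable]: "X \<in> borel_measurable P"
    using assms P by (simp cong: measurable_cong_sets)
  have "(\<integral>\<^sup>+\<omega>. ennreal \<bar>c * X \<omega>\<bar> \<partial>P) = ennreal \<bar>c\<bar> * (\<integral>\<^sup>+\<omega>. ennreal \<bar>X \<omega>\<bar> \<partial>P)"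
    by (simp add: abs_mult ennreal_mult nn_integral_cmult)
  also have "\<dots> \<le> ennreal \<bar>c\<bar> * (SUP P\<in>M. \<integral>\<^sup>+\<omega>. ennreal \<bar>X \<omega>\<bar> \<partial>P)"
    using P by (intro mult_left_mono SUP_upper) auto
  finally show "(\<integral>\<^sup>+\<omega>. ennreal \<bar>c * X \<omega>\<bar> \<partial>P) \<le> \<dots>" .
qed

lemma L1_const: "(\<lambda>\<omega>. c) \<in> L1 M"
proof -
  \<comment> \<open>For empty \<open>M\<close> the supremum is \<open>bot\<close>, which is 0 in
    \<open>ennreal\<close>.\<close>
  have "sup_norm M (\<lambda>\<omega>. c - c) = 0"
    by (cases "M = {}") (simp_all add: sup_norm_def bot_ennreal)
  then show ?thesis
    unfolding L1_def by (auto intro!: exI[of _ "\<lambda>_. c"])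
qed

lemma L1_add:
  assumes M: "\<forall>P\<in>M. sets P = sets borel" and X: "X \<in> L1 M" and Y: "Y \<in> L1 M"
  shows "(\<lambda>\<omega>. X \<omega> + Y \<omega>) \<in> L1 M"
proof -
  have m: "X \<in> borel_measurable borel" "Y \<in> borel_measurable borel"
    using X Y by (auto simp: L1_def)
  have "\<exists>h. continuous_on UNIV h \<and> bounded (range h) \<and> sup_norm M (\<lambda>\<omega>. X \<omega> + Y \<omega> - h \<omega>) < e"
    if "e > 0" for e
  proof -
    define e' where "e' = e / 2"
    have "e' + e' = e / 2 * 2"
      by (simp add: e'_def mult_2_right)
    also have "\<dots> = e"
      by (subst ennreal_divide_times) (simp add: ennreal_divide_self)
    finally have e': "e' > 0" "e' + e' = e"
      using that by (auto simp: e'_def ennreal_zero_less_divide)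
    obtain f g where fg: "continuous_on UNIV f" "bounded (range f)" "sup_norm M (\<lambda>\<omega>. X \<omega> - f \<omega>) < e'"
      "continuous_on UNIV g" "bounded (range g)" "sup_norm M (\<lambda>\<omega>. Y \<omega> - g \<omega>) < e'"
      using X Y e' unfolding L1_def by blast
    have [measurable]: "f \<in> borel_measurable borel" "g \<in> borel_measurable borel"
      using fg by (auto intro: borel_measurable_continuous_onI)
    have "sup_norm M (\<lambda>\<omega>. (X \<omega> - f \<omega>) + (Y \<omega> - g \<omega>)) < e' + e'"
      using m fg by (intro le_less_trans[OF sup_norm_add_le[OF M]] add_strict_mono) auto
    moreover have "bounded (range (\<lambda>\<omega>. f \<omega> + g \<omega>))"
      using fg by (intro bounded_plus_comp)
    ultimately show ?thesis
      using fg e' by (intro exI[of _ "\<lambda>\<omega>. f \<omega> + g \<omega>"])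
        (auto simp: algebra_simps intro: continuous_on_add)
  qed
  then show ?thesis
    using m by (auto simp: L1_def)
qed

lemma L1_cmult:
  assumes M: "\<forall>P\<in>M. sets P = sets borel" and X: "X \<in> L1 M"
  shows "(\<lambda>\<omega>. c * X \<omega>) \<in> L1 M"
proof (cases "c = 0")
  \<comment> \<open>The zero scalar is treated apart: multiplying the tolerance
    \<open>e / ennreal \<bar>c\<bar>\<close> by \<open>ennreal \<bar>c\<bar>\<close> gives back
    \<open>e\<close> only for nonzero \<open>c\<close>.\<close>
  case True
  then show ?thesis
    using L1_const[of 0 M] by simp
next
  case False
  have m: "X \<in> borel_measurable borel"
    using X by (auto simp: L1_def)
  have "\<exists>h. continuous_on UNIV h \<and> bounded (range h) \<and> sup_norm M (\<lambda>\<omega>. c * X \<omega> - h \<omega>) < e"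
    if "e > 0" for e
  proof -
    define e' where "e' = e / ennreal \<bar>c\<bar>"
    have e': "e' > 0" "ennreal \<bar>c\<bar> * e' = e"
      using that False by (auto simp: e'_def ennreal_zero_less_divide ennreal_mult_divide_eq
          ennreal_times_divide mult.commute[of _ e])
    obtain f where f: "continuous_on UNIV f" "bounded (range f)" "sup_norm M (\<lambda>\<omega>. X \<omega> - f \<omega>) < e'"
      using X e' unfolding L1_def by blast
    have [measurable]: "f \<in> borel_measurable borel"
      using f by (auto intro: borel_measurable_continuous_onI)
    have "sup_norm M (\<lambda>\<omega>. c * (X \<omega> - f \<omega>)) < ennreal \<bar>c\<bar> * e'"
      using m f False
      by (intro le_less_trans[OF sup_norm_cmult_le[OF M]] ennreal_mult_strict_left_mono) auto
    moreover have "bounded (range (\<lambda>\<omega>. c * f \<omega>))"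
      using bounded_scaling[OF f(2), of c] by (simp add: image_image)
    ultimately show ?thesis
      using f e' by (intro exI[of _ "\<lambda>\<omega>. c * f \<omega>"])
        (auto simp: algebra_simps intro: continuous_on_mult_left)
  qed
  then show ?thesis
    using m by (auto simp: L1_def)
qed

lemma L1_sum:
  assumes M: "\<forall>P\<in>M. sets P = sets borel" and "finite J" "\<And>j. j \<in> J \<Longrightarrow> f j \<in> L1 M"
  shows "(\<lambda>\<omega>. \<Sum>j\<in>J. f j \<omega>) \<in> L1 M"
  using assms(2,3)
proof (induction J rule: finite_induct)
  case empty
  then show ?case by (simp add: L1_const)
next
  case (insert j J)
  then show ?case by (simp add: L1_add[OF M])
qed

lemma dual_sum:
  assumes M: "\<forall>P\<in>M. sets P = sets borel" and \<phi>: "\<phi> \<in> dual (L1 M) \<tau>"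
    and "finite J" "\<And>j. j \<in> J \<Longrightarrow> f j \<in> L1 M"
  shows "\<phi> (\<lambda>\<omega>. \<Sum>j\<in>J. f j \<omega>) = (\<Sum>j\<in>J. \<phi> (f j))"
  using assms(3,4)
proof (induction J rule: finite_induct)
  case empty
  \<comment> \<open>The empty sum is the zero claim, whose value is 0 by homogeneity with scalar
    0.\<close>
  have "\<forall>X\<in>L1 M. \<phi> (\<lambda>\<omega>. 0 * X \<omega>) = 0 * \<phi> X"
    using \<phi> unfolding dual_def by blast
  from bspec[OF this L1_const] show ?case
    by simp
next
  case (insert j J)
  then show ?case
    using \<phi> L1_sum[OF M, of J f] by (simp add: dual_def)
qed

section \<open>Finiteness of the seminorm and integrability under each member of
  \<open>M\<close>\<close>

text \<open>\<open>X\<close> is within distance 1 of a bounded continuous \<open>f\<close>, and a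
  uniform bound of \<open>f\<close> also bounds its seminorm because every member of
  \<open>M\<close> has total mass 1.\<close>

lemma sup_norm_finite:
  assumes M: "\<forall>P\<in>M. prob_space P \<and> sets P = sets borel" and X: "X \<in> L1 M"
  shows "sup_norm M X < \<top>"
proof -
  obtain f where f: "continuous_on UNIV f" "bounded (range f)" "sup_norm M (\<lambda>\<omega>. X \<omega> - f \<omega>) < 1"
    using X unfolding L1_def by (auto dest: spec[of _ 1])
  have m: "X \<in> borel_measurable borel" "f \<in> borel_measurable borel"
    using X f by (auto simp: L1_def intro: borel_measurable_continuous_onI)
  obtain C where C: "\<And>\<omega>. \<bar>f \<omega>\<bar> \<le> C"
    using f(2) by (auto simp: bounded_iff)
  have "sup_norm M f \<le> ennreal C"
    unfolding sup_norm_def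
  proof (rule SUP_least)
    fix P assume "P \<in> M"
    then have "prob_space P"
      using M by auto
    have "(\<integral>\<^sup>+\<omega>. ennreal \<bar>f \<omega>\<bar> \<partial>P) \<le> (\<integral>\<^sup>+\<omega>. ennreal C \<partial>P)"
      using C by (intro nn_integral_mono ennreal_leI)
    also have "\<dots> = ennreal C"
      using prob_space.emeasure_space_1[OF \<open>prob_space P\<close>] by simp
    finally show "(\<integral>\<^sup>+\<omega>. ennreal \<bar>f \<omega>\<bar> \<partial>P) \<le> ennreal C" .
  qed
  moreover have "sup_norm M (\<lambda>\<omega>. (X \<omega> - f \<omega>) + f \<omega>) \<le> sup_norm M (\<lambda>\<omega>. X \<omega> - f \<omega>) + sup_norm M f"
    using M m by (intro sup_norm_add_le) auto
  ultimately have "sup_norm M X \<le> 1 + ennreal C"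
    using f(3) by (auto intro: order_trans add_mono less_imp_le)
  also have "\<dots> < \<top>"
    by (simp add: less_top)
  finally show ?thesis .
qed

text \<open>The bound on the expectation does not depend on \<open>P\<close>; it supplies the
  coordinate bounds required for the separation.\<close>

lemma L1_integrable:
  assumes M: "\<forall>P\<in>M. prob_space P \<and> sets P = sets borel" and X: "X \<in> L1 M" and P: "P \<in> M"
  shows "integrable P X" and "\<bar>\<integral>\<omega>. X \<omega> \<partial>P\<bar> \<le> enn2real (sup_norm M X)"
proof -
  have m: "X \<in> borel_measurable P"
    using M X P by (auto simp: L1_def cong: measurable_cong_sets)
  have le: "(\<integral>\<^sup>+\<omega>. ennreal \<bar>X \<omega>\<bar> \<partial>P) \<le> sup_norm M X"
    unfolding sup_norm_def using P by (intro SUP_upper)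
  then show int: "integrable P X"
    using m sup_norm_finite[OF M X] by (auto simp: integrable_iff_bounded)
  have "\<bar>\<integral>\<omega>. X \<omega> \<partial>P\<bar> \<le> (\<integral>\<omega>. \<bar>X \<omega>\<bar> \<partial>P)"
    by (rule integral_abs_bound)
  also have "\<dots> = enn2real (\<integral>\<^sup>+\<omega>. ennreal \<bar>X \<omega>\<bar> \<partial>P)"
    using m by (intro integral_eq_nn_integral) auto
  also have "\<dots> \<le> enn2real (sup_norm M X)"
    using le sup_norm_finite[OF M X] by (intro enn2real_mono)
  finally show "\<bar>\<integral>\<omega>. X \<omega> \<partial>P\<bar> \<le> enn2real (sup_norm M X)" .
qed

section \<open>From weak* closedness to membership in \<open>M\<close>\<close>

text \<open>A basic weak* neighbourhood constrains only finitely many claims \<open>J\<close>. Using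
  these claims as coordinates turns the question into separating the point \<open>\<phi>\<close>
  from the convex bounded set of expectations.\<close>

lemma positive_normalized_functional_in_closed_set:
  fixes M :: "'a::metric_space measure set"
  assumes prob: "\<forall>P\<in>M. prob_space P \<and> sets P = sets borel"
    and convex: "convex_measures M"
    and closed: "weak_star_closed M"
    and \<phi>: "\<phi> \<in> dual_pos (L1 M) (L1_topology M) (mean_le M)" "\<phi> (\<lambda>\<omega>. 1) = 1"
  shows "\<phi> \<in> expectation_functional M ` M"
proof (rule ccontr)
  let ?K = "expectation_functional M ` M"
  let ?E = "dual (L1 M) (L1_topology M)"
  assume notin: "\<phi> \<notin> ?K"
  have sets: "\<forall>P\<in>M. sets P = sets borel"
    using prob by simp
  have dual: "\<phi> \<in> ?E"
    using \<phi>(1) by (simp add: dual_pos_def)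
  \<comment> \<open>Members of the dual are extensional, hence points of the product space, and the
    subtopology has the whole dual as its carrier.\<close>
  have top: "topspace (weak_star_topology (L1 M) (L1_topology M)) = ?E"
    by (auto simp: weak_star_topology_def dual_def PiE_def)
  have K: "?K \<subseteq> ?E" "openin (weak_star_topology (L1 M) (L1_topology M)) (?E - ?K)"
    using closed unfolding weak_star_closed_def closedin_def top by auto
  then obtain W where W: "openin (product_topology (\<lambda>_. euclideanreal) (L1 M)) W" "?E - ?K = W \<inter> ?E"
    unfolding weak_star_topology_def openin_subtopology by auto
  with dual notin have "\<phi> \<in> W"
    by auto
  then obtain U where U: "finite {X \<in> L1 M. U X \<noteq> UNIV}" "\<And>X. X \<in> L1 M \<Longrightarrow> open (U X)"
    "\<phi> \<in> Pi\<^sub>E (L1 M) U" "Pi\<^sub>E (L1 M) U \<subseteq> W"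
    using W(1) unfolding openin_product_topology_alt by force
  define J where "J = {X \<in> L1 M. U X \<noteq> UNIV}"
  have J: "finite J" "J \<subseteq> L1 M"
    using U by (auto simp: J_def)
  have "\<forall>X\<in>J. \<exists>e>0. ball (\<phi> X) e \<subseteq> U X"
  proof
    fix X assume "X \<in> J"
    then have "X \<in> L1 M"
      using J by auto
    then have "open (U X)" "\<phi> X \<in> U X"
      using U by (auto simp: PiE_iff)
    then show "\<exists>e>0. ball (\<phi> X) e \<subseteq> U X"
      by (rule openE) auto
  qed
  then obtain r where r: "\<And>X. X \<in> J \<Longrightarrow> 0 < r X" "\<And>X. X \<in> J \<Longrightarrow> ball (\<phi> X) (r X) \<subseteq> U X"
    by metis
  \<comment> \<open>The inserted 1 keeps the minimum defined and positive when \<open>J\<close> is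
    empty.\<close>
  define e where "e = Min (insert 1 (r ` J))"
  have e: "0 < e" "\<And>X. X \<in> J \<Longrightarrow> e \<le> r X"
    using J r by (auto simp: e_def)
  \<comment> \<open>An expectation functional closer than \<open>e\<close> on \<open>J\<close> would
    lie in the box given by \<open>U\<close>, hence in \<open>W\<close>, which within the dual is
    the complement of the expectation functionals.\<close>
  have distant: "e\<^sup>2 \<le> (\<Sum>X\<in>J. (\<phi> X - k X)\<^sup>2)" if k: "k \<in> ?K" for k
  proof (rule ccontr)
    assume "\<not> ?thesis"
    then have less: "(\<Sum>X\<in>J. (\<phi> X - k X)\<^sup>2) < e\<^sup>2"
      by simp
    have "k X \<in> U X" if X: "X \<in> L1 M" for X
    proof (cases "X \<in> J")
      case True
      have "(\<phi> X - k X)\<^sup>2 \<le> (\<Sum>X\<in>J. (\<phi> X - k X)\<^sup>2)"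
        using J True by (intro member_le_sum) auto
      with less have "\<bar>\<phi> X - k X\<bar>\<^sup>2 < e\<^sup>2"
        by simp
      then have "\<bar>\<phi> X - k X\<bar> < e"
        using power_less_imp_less_base[of "\<bar>\<phi> X - k X\<bar>" 2 e] e(1) by simp
      then show ?thesis
        using e(2)[OF True] r(2)[OF True] by (auto simp: dist_real_def)
    next
      case False
      then show ?thesis
        using X by (auto simp: J_def)
    qed
    then have "k \<in> Pi\<^sub>E (L1 M) U"
      using k by (auto simp: expectation_functional_def)
    then show False
      using U(4) W(2) K(1) k by blast
  qed
  \<comment> \<open>Convexity of \<open>M\<close> is stated on events;
    \<open>integral_mixture\<close> transfers it to the expectations of all claims.\<close>
  have mixture: "\<exists>z\<in>?K. \<forall>X\<in>J. z X = (1 - u) * x X + u * y X"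
    if xy: "x \<in> ?K" "y \<in> ?K" "u \<in> {0..1}" for x y u
  proof -
    obtain P Q where PQ: "P \<in> M" "Q \<in> M" "x = expectation_functional M P" "y = expectation_functional M Q"
      using xy by auto
    obtain R where R: "R \<in> M" "sets R = sets P"
      "\<And>A. A \<in> sets P \<Longrightarrow> measure R A = (1 - u) * measure P A + u * measure Q A"
      using convex PQ(1,2) xy(3) unfolding convex_measures_def by meson
    have "(\<integral>\<omega>. X \<omega> \<partial>R) = (1 - u) * (\<integral>\<omega>. X \<omega> \<partial>P) + u * (\<integral>\<omega>. X \<omega> \<partial>Q)" if "X \<in> L1 M" for X
      using PQ(1,2) R xy(3) prob that
      by (intro integral_mixture) (auto intro: L1_integrable prob_space.finite_measure)
    then show ?thesis
      using J PQ R(1) by (intro bexI[of _ "expectation_functional M R"])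
        (auto simp: expectation_functional_def)
  qed
  have bounded: "\<bar>k X\<bar> \<le> enn2real (sup_norm M X)" if "k \<in> ?K" "X \<in> J" for k X
    using that J L1_integrable(2)[OF prob] by (auto simp: expectation_functional_def)
  have "\<exists>a c. (\<forall>k\<in>?K. (\<Sum>X\<in>J. a X * k X) \<le> c) \<and> c < (\<Sum>X\<in>J. a X * \<phi> X)"
    using e(1)
    by (intro separation_of_distant_point[of ?K J "\<lambda>X. enn2real (sup_norm M X)" "e\<^sup>2"]
        mixture bounded distant) simp_all
  then obtain a c where sep: "\<forall>k\<in>?K. (\<Sum>X\<in>J. a X * k X) \<le> c" and c: "c < (\<Sum>X\<in>J. a X * \<phi> X)"
    by auto
  define Z where "Z = (\<lambda>\<omega>. \<Sum>X\<in>J. a X * X \<omega>)"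
  have Z: "Z \<in> L1 M"
    unfolding Z_def using J by (intro L1_sum[OF sets] L1_cmult[OF sets]) auto
  have "\<phi> Z = (\<Sum>X\<in>J. a X * \<phi> X)"
  proof -
    have "\<phi> Z = (\<Sum>X\<in>J. \<phi> (\<lambda>\<omega>. a X * X \<omega>))"
      unfolding Z_def using J by (intro dual_sum[OF sets dual] L1_cmult[OF sets]) auto
    also have "\<dots> = (\<Sum>X\<in>J. a X * \<phi> X)"
      using J dual by (intro sum.cong) (auto simp: dual_def)
    finally show ?thesis .
  qed
  \<comment> \<open>This is \<open>c - Z\<close>, written as a combination of the constant 1 and
    \<open>Z\<close> so that linearity and \<open>\<phi> (\<lambda>\<omega>. 1) = 1\<close> give
    \<open>\<phi> Y = c - \<phi> Z\<close>.\<close>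
  define Y where "Y = (\<lambda>\<omega>. c * 1 + (-1) * Z \<omega>)"
  have Y: "Y \<in> L1 M"
    unfolding Y_def by (intro L1_add[OF sets] L1_cmult[OF sets] L1_const Z)
  have additive: "\<phi> (\<lambda>\<omega>. X \<omega> + X' \<omega>) = \<phi> X + \<phi> X'" if "X \<in> L1 M" "X' \<in> L1 M" for X X'
    using dual that by (simp add: dual_def)
  have homogeneous: "\<phi> (\<lambda>\<omega>. b * X \<omega>) = b * \<phi> X" if "X \<in> L1 M" for X b
    using dual that unfolding dual_def by blast
  have "\<phi> Y = \<phi> (\<lambda>\<omega>. c * 1) + \<phi> (\<lambda>\<omega>. (-1) * Z \<omega>)"
    unfolding Y_def by (intro additive L1_cmult[OF sets] L1_const Z)
  also have "\<dots> = c * \<phi> (\<lambda>\<omega>. 1) + (-1) * \<phi> Z"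
    by (simp only: homogeneous[OF Z] homogeneous[OF L1_const])
  finally have "\<phi> Y < 0"
    using c \<open>\<phi> Z = _\<close> \<phi>(2) by simp
  moreover have "mean_le M (\<lambda>\<omega>. 0) Y"
    unfolding mean_le_def
  proof
    fix P assume P: "P \<in> M"
    then interpret prob_space P
      using prob by auto
    have int: "integrable P X" if "X \<in> L1 M" for X
      using L1_integrable(1)[OF prob that P] .
    have "(\<integral>\<omega>. Z \<omega> \<partial>P) = (\<Sum>X\<in>J. a X * (\<integral>\<omega>. X \<omega> \<partial>P))"
      unfolding Z_def using J int by (subst Bochner_Integration.integral_sum) auto
    also have "\<dots> = (\<Sum>X\<in>J. a X * expectation_functional M P X)"
      using J by (intro sum.cong) (auto simp: expectation_functional_def)
    also have "\<dots> \<le> c"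
      using sep P by auto
    finally show "(\<integral>\<omega>. 0 \<partial>P) \<le> (\<integral>\<omega>. Y \<omega> \<partial>P)"
      using int[OF Z] by (simp add: Y_def prob_space)
  qed
  ultimately show False
    using \<phi>(1) Y unfolding dual_pos_def by fastforce
qed

theorem proposition3p3:
  fixes M :: "'a::metric_space measure set"
    and T :: nat
    and F :: "nat \<Rightarrow> 'a measure"
    and S :: "nat \<Rightarrow> 'a \<Rightarrow> real ^ 'j"
  assumes prob: "\<forall>P\<in>M. prob_space P \<and> sets P = sets borel"
    and convex: "convex_measures M"
    and closed: "weak_star_closed M"
    and horizon: "T \<ge> 1"
    and filtration: "filtration_upto borel T F"
    and adapted: "\<forall>t\<le>T. S t \<in> borel_measurable (F t)"
    and nonneg: "\<forall>t\<le>T. \<forall>\<omega> j. 0 \<le> S t \<omega> $ j"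
    and viable: "viable (L1 M) (L1_topology M) (mean_le M) (net_trades M T F S) (relevant_claims M)"
  shows "\<forall>\<phi>\<in>ac_martingale_functionals (L1 M) (L1_topology M) (mean_le M) (net_trades M T F S).
           \<exists>P\<in>M. \<forall>X\<in>L1 M. \<phi> X = (\<integral>\<omega>. X \<omega> \<partial>P)"
proof
  fix \<phi> assume "\<phi> \<in> ac_martingale_functionals (L1 M) (L1_topology M) (mean_le M) (net_trades M T F S)"
  \<comment> \<open>Martingale functionals are positive and take the value 1 at the constant claim
    1, which places \<open>\<phi>\<close> in the image of \<open>M\<close>.\<close>
  then have "\<phi> \<in> expectation_functional M ` M"
    using positive_normalized_functional_in_closed_set[OF prob convex closed, of \<phi>]
    by (simp add: ac_martingale_functionals_def martingale_functionals_def)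
  then show "\<exists>P\<in>M. \<forall>X\<in>L1 M. \<phi> X = (\<integral>\<omega>. X \<omega> \<partial>P)"
    by (auto simp: expectation_functional_def)
qed

end
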